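(* Let $X$ be a second-countable $T_3$ space. Then the following statements are equivalent: (1) the Scott space $\Sigma\operatorname{RO}(X)$ is sober; (2) the complete Boolean algebra $\operatorname{RO}(X)$ is atomic; (3) $\operatorname{cl}_X(\operatorname{Iso}(X))=X$.
   Context: A $T_3$ space is a space that is both regular and $T_1$. An open set $U\subseteq X$ is regular open if $U=\operatorname{int}_X(\operatorname{cl}_X(U))$; $\operatorname{RO}(X)$ is the set of all regular open subsets of $X$ ordered by inclusion, which is a complete Boolean algebra (with $\bigvee\mathcal A=\operatorname{int}_X(\operatorname{cl}_X(\bigcup\mathcal A))$, $\bigwedge\mathcal A=\operatorname{int}_X(\bigcap\mathcal A)$, $\neg U=\operatorname{int}_X(X\setminus U)$). $\operatorname{Iso}(X)$ is the set of isolated points of $X$, i.e. points $x$ with $\{x\}$ open. For a poset $P$, a subset $U$ is Scott open if it is an upper set and, for each directed $D\subseteq P$ whose supremum exists, $\bigvee D\in U$ implies $D\cap U\neq\emptyset$; $\Sigma P$ denotes $P$ with the topology of Scott open sets (the Scott space of $P$). A nonempty subset $A$ of a space is irreducible if, whenever $A\subseteq C_1\cup C_2$ with $C_1,C_2$ closed, $A\subseteq C_1$ or $A\subseteq C_2$. A $T_0$ space is sober if every irreducible closed set is the closure of a singleton. A nonzero element $a$ of a Boolean algebra is an atom if the only $b$ with $0<b\le a$ is $a$; a Boolean algebra is atomic if every nonzero element has an atom below it. *)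

theory Defs
  imports "HOL-Analysis.Analysis" "HOL-Algebra.Complete_Lattice"
begin

text \<open>Avoids ambiguity with the infix \<open>closure_of\<close> on abstract topologies.\<close>
no_notation eq_closure_of (\<open>closure'_of\<index>\<close>)

section \<open>Scott spaces\<close>

definition directed_in :: "('a, 'b) gorder_scheme \<Rightarrow> 'a set \<Rightarrow> bool" where
  "directed_in P D \<longleftrightarrow> D \<subseteq> carrier P \<and> D \<noteq> {} \<and>
     (\<forall>x\<in>D. \<forall>y\<in>D. \<exists>z\<in>D. x \<sqsubseteq>\<^bsub>P\<^esub> z \<and> y \<sqsubseteq>\<^bsub>P\<^esub> z)"

definition scott_open :: "('a, 'b) gorder_scheme \<Rightarrow> 'a set \<Rightarrow> bool" where
  "scott_open P U \<longleftrightarrow> U \<subseteq> carrier P \<and>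
     (\<forall>x\<in>U. \<forall>y\<in>carrier P. x \<sqsubseteq>\<^bsub>P\<^esub> y \<longrightarrow> y \<in> U) \<and>
     (\<forall>D s. directed_in P D \<and> is_lub P s D \<and> s \<in> U \<longrightarrow> D \<inter> U \<noteq> {})"

definition scott_space :: "('a, 'b) gorder_scheme \<Rightarrow> 'a topology" where
  "scott_space P = topology (scott_open P)"

lemma istopology_scott_open: "istopology (scott_open P)"
  unfolding istopology_def
proof (intro conjI allI impI)
  fix U V
  assume U: "scott_open P U" and V: "scott_open P V"
  have "D \<inter> (U \<inter> V) \<noteq> {}"
    if D: "directed_in P D" and s: "is_lub P s D" "s \<in> U \<inter> V" for D s
  proof -
    obtain x y where "x \<in> D" "x \<in> U" "y \<in> D" "y \<in> V"
      using U V D s unfolding scott_open_def by blast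
    moreover obtain z where "z \<in> D" "x \<sqsubseteq>\<^bsub>P\<^esub> z" "y \<sqsubseteq>\<^bsub>P\<^esub> z" "z \<in> carrier P"
      using D calculation unfolding directed_in_def by blast
    ultimately show ?thesis
      using U V unfolding scott_open_def by blast
  qed
  with U V show "scott_open P (U \<inter> V)"
    unfolding scott_open_def by blast
next
  fix \<K>
  assume *: "\<forall>K\<in>\<K>. scott_open P K"
  have "D \<inter> \<Union>\<K> \<noteq> {}"
    if D: "directed_in P D" and s: "is_lub P s D" "s \<in> \<Union>\<K>" for D s
  proof -
    obtain K where K: "K \<in> \<K>" "s \<in> K" using s by blast
    then have "D \<inter> K \<noteq> {}"
      using * D s unfolding scott_open_def by blast
    then show ?thesis using K by blast
  qed
  moreover have "\<Union>\<K> \<subseteq> carrier P" "\<forall>x\<in>\<Union>\<K>. \<forall>y\<in>carrier P. x \<sqsubseteq>\<^bsub>P\<^esub> y \<longrightarrow> y \<in> \<Union>\<K>"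
    using * unfolding scott_open_def by blast+
  ultimately show "scott_open P (\<Union>\<K>)"
    unfolding scott_open_def by blast
qed

lemma openin_scott_space: "openin (scott_space P) U \<longleftrightarrow> scott_open P U"
  by (simp add: scott_space_def istopology_scott_open topology_inverse')

lemma topspace_scott_space: "topspace (scott_space P) = carrier P"
proof
  show "topspace (scott_space P) \<subseteq> carrier P"
    by (metis openin_scott_space openin_topspace scott_open_def)
  have "scott_open P (carrier P)"
    unfolding scott_open_def directed_in_def by blast
  then show "carrier P \<subseteq> topspace (scott_space P)"
    by (simp add: openin_scott_space openin_subset)
qed


section \<open>Sobriety\<close>

definition irreducible_in :: "'a topology \<Rightarrow> 'a set \<Rightarrow> bool" where
  "irreducible_in X A \<longleftrightarrow> A \<subseteq> topspace X \<and> A \<noteq> {} \<and>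
     (\<forall>C1 C2. closedin X C1 \<and> closedin X C2 \<and> A \<subseteq> C1 \<union> C2 \<longrightarrow> A \<subseteq> C1 \<or> A \<subseteq> C2)"

definition sober_space :: "'a topology \<Rightarrow> bool" where
  "sober_space X \<longleftrightarrow> t0_space X \<and>
     (\<forall>A. closedin X A \<and> irreducible_in X A \<longrightarrow> (\<exists>x\<in>topspace X. A = X closure_of {x}))"


section \<open>Atoms\<close>

definition atom_in :: "('a, 'b) gorder_scheme \<Rightarrow> 'a \<Rightarrow> bool" where
  "atom_in B a \<longleftrightarrow> a \<in> carrier B \<and> a \<noteq> \<bottom>\<^bsub>B\<^esub> \<and>
     (\<forall>b\<in>carrier B. b \<noteq> \<bottom>\<^bsub>B\<^esub> \<and> b \<sqsubseteq>\<^bsub>B\<^esub> a \<longrightarrow> b = a)"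

definition atomic_order :: "('a, 'b) gorder_scheme \<Rightarrow> bool" where
  "atomic_order B \<longleftrightarrow>
     (\<forall>b\<in>carrier B. b \<noteq> \<bottom>\<^bsub>B\<^esub> \<longrightarrow> (\<exists>a. atom_in B a \<and> a \<sqsubseteq>\<^bsub>B\<^esub> b))"


section \<open>Regular open sets and isolated points\<close>

definition regular_openin :: "'a topology \<Rightarrow> 'a set \<Rightarrow> bool" where
  "regular_openin X U \<longleftrightarrow> openin X U \<and> U = X interior_of (X closure_of U)"

definition RO :: "'a topology \<Rightarrow> 'a set gorder" where
  "RO X = \<lparr>carrier = {U. regular_openin X U}, eq = (=), le = (\<subseteq>)\<rparr>"

definition Iso :: "'a topology \<Rightarrow> 'a set" where
  "Iso X = {x \<in> topspace X. openin X {x}}"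


section \<open>The regular open sets form a complete Boolean algebra\<close>

lemma carrier_RO [simp]: "carrier (RO X) = {U. regular_openin X U}"
  and eq_RO [simp]: "eq (RO X) = (=)"
  and le_RO [simp]: "le (RO X) = (\<subseteq>)"
  by (simp_all add: RO_def)

lemma regular_openin_int_cl:
  "regular_openin X (X interior_of (X closure_of S))"
proof -
  have "X interior_of (X closure_of S)
      \<subseteq> X interior_of (X closure_of (X interior_of (X closure_of S)))"
    by (simp add: closure_of_subset interior_of_maximal interior_of_subset_topspace)
  moreover have "X closure_of (X interior_of (X closure_of S)) \<subseteq> X closure_of S"
    by (simp add: closure_of_minimal interior_of_subset)
  ultimately show ?thesis
    unfolding regular_openin_def by (meson interior_of_mono openin_interior_of subset_antisym)
qed

lemma open_subset_int_cl:
  "openin X U \<Longrightarrow> U \<subseteq> X interior_of (X closure_of U)"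
  by (simp add: closure_of_subset interior_of_maximal openin_subset)

lemma partial_order_RO: "partial_order (RO X)"
  by unfold_locales (auto simp: RO_def)

lemma is_lub_RO:
  assumes "\<A> \<subseteq> carrier (RO X)"
  shows "is_lub (RO X) (X interior_of (X closure_of \<Union>\<A>)) \<A>"
proof (rule least_UpperI)
  have "openin X (\<Union>\<A>)"
    using assms by (auto simp: regular_openin_def)
  then show "le (RO X) U (X interior_of (X closure_of \<Union>\<A>))" if "U \<in> \<A>" for U
    using that open_subset_int_cl[of X "\<Union>\<A>"] by auto
  show "le (RO X) (X interior_of (X closure_of \<Union>\<A>)) V" if "V \<in> Upper (RO X) \<A>" for V
  proof -
    have "\<Union>\<A> \<subseteq> V" "regular_openin X V"
      using that assms by (auto simp: Upper_def)
    then show ?thesis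
      by (metis closure_of_mono interior_of_mono le_RO regular_openin_def)
  qed
qed (use assms in \<open>auto simp: regular_openin_int_cl\<close>)

text \<open>The meet is taken inside \<^term>\<open>topspace X\<close>, so that the empty family has
  meet \<^term>\<open>topspace X\<close>.\<close>

lemma is_glb_RO:
  assumes "\<A> \<subseteq> carrier (RO X)"
  shows "is_glb (RO X) (X interior_of (topspace X \<inter> \<Inter>\<A>)) \<A>"
proof (rule greatest_LowerI)
  let ?I = "X interior_of (topspace X \<inter> \<Inter>\<A>)"
  show "le (RO X) ?I U" if "U \<in> \<A>" for U
    using that interior_of_subset[of X "topspace X \<inter> \<Inter>\<A>"] by auto
  show "le (RO X) V ?I" if "V \<in> Lower (RO X) \<A>" for V
  proof -
    have "V \<subseteq> topspace X \<inter> \<Inter>\<A>" "openin X V"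
      using that assms by (auto simp: Lower_def regular_openin_def dest: openin_subset) blast
    then show ?thesis by (simp add: interior_of_maximal)
  qed
  have "X interior_of (X closure_of ?I) \<subseteq> U" if "U \<in> \<A>" for U
  proof -
    have "?I \<subseteq> U" "regular_openin X U"
      using that assms interior_of_subset[of X "topspace X \<inter> \<Inter>\<A>"] by auto
    then show ?thesis
      by (metis closure_of_mono interior_of_mono regular_openin_def)
  qed
  then have "X interior_of (X closure_of ?I) \<subseteq> topspace X \<inter> \<Inter>\<A>"
    using interior_of_subset_topspace by fastforce
  then have "X interior_of (X closure_of ?I) \<subseteq> ?I"
    by (simp add: interior_of_maximal)
  then show "?I \<in> carrier (RO X)"
    using open_subset_int_cl[of X ?I] by (auto simp: regular_openin_def)
qed (use assms in auto)

lemma complete_lattice_RO: "complete_lattice (RO X)"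
proof -
  interpret partial_order "RO X" by (rule partial_order_RO)
  show ?thesis
    by unfold_locales (use is_lub_RO is_glb_RO in blast)+
qed

lemma bottom_RO: "\<bottom>\<^bsub>RO X\<^esub> = {}"
proof -
  interpret complete_lattice "RO X" by (rule complete_lattice_RO)
  show ?thesis
    using bottom_lower[of "{}"] by (simp add: regular_openin_def)
qed

lemma top_RO: "\<top>\<^bsub>RO X\<^esub> = topspace X"
proof -
  interpret complete_lattice "RO X" by (rule complete_lattice_RO)
  show ?thesis
    using top_higher[of "topspace X"] top_closed
    by (simp add: regular_openin_def openin_subset subset_antisym)
qed

lemma join_RO:
  assumes "regular_openin X U" "regular_openin X V"
  shows "U \<squnion>\<^bsub>RO X\<^esub> V = X interior_of (X closure_of (U \<union> V))"
proof -
  interpret complete_lattice "RO X" by (rule complete_lattice_RO)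
  have "is_lub (RO X) (X interior_of (X closure_of (U \<union> V))) {U, V}"
    using is_lub_RO[of "{U, V}" X] assms by simp
  then show ?thesis
    using joinI[of U V "\<lambda>l. l = X interior_of (X closure_of (U \<union> V))"] assms
      least_unique[of _ "Upper (RO X) {U, V}"] by fastforce
qed

lemma meet_RO:
  assumes "regular_openin X U" "regular_openin X V"
  shows "U \<sqinter>\<^bsub>RO X\<^esub> V = U \<inter> V"
proof -
  interpret complete_lattice "RO X" by (rule complete_lattice_RO)
  have "openin X (U \<inter> V)" "U \<inter> V \<subseteq> topspace X"
    using assms by (auto simp: regular_openin_def dest: openin_subset)
  then have "X interior_of (topspace X \<inter> \<Inter>{U, V}) = U \<inter> V"
    by (simp add: Int_absorb1 interior_of_openin)
  then have "is_glb (RO X) (U \<inter> V) {U, V}"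
    using is_glb_RO[of "{U, V}" X] assms by simp
  then show ?thesis
    using meetI[of U V "\<lambda>l. l = U \<inter> V"] assms
      greatest_unique[of _ "Lower (RO X) {U, V}"] by fastforce
qed

lemma distrib_RO:
  assumes U: "regular_openin X U" and V: "regular_openin X V" and W: "regular_openin X W"
  shows "U \<sqinter>\<^bsub>RO X\<^esub> (V \<squnion>\<^bsub>RO X\<^esub> W) = (U \<sqinter>\<^bsub>RO X\<^esub> V) \<squnion>\<^bsub>RO X\<^esub> (U \<sqinter>\<^bsub>RO X\<^esub> W)"
proof -
  interpret complete_lattice "RO X" by (rule complete_lattice_RO)
  have UV: "regular_openin X (U \<inter> V)" and UW: "regular_openin X (U \<inter> W)"
    using meet_closed[of U V] meet_closed[of U W] assms by (simp_all add: meet_RO)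
  have VW: "regular_openin X (X interior_of (X closure_of (V \<union> W)))"
    by (rule regular_openin_int_cl)
  have op: "openin X U" using U by (simp add: regular_openin_def)
  have "U \<inter> X interior_of (X closure_of (V \<union> W)) \<subseteq> U \<inter> X closure_of (V \<union> W)"
    using interior_of_subset by fastforce
  also have "\<dots> \<subseteq> X closure_of (U \<inter> (V \<union> W))"
    using op by (rule openin_Int_closure_of_subset)
  also have "\<dots> = X closure_of (U \<inter> V \<union> U \<inter> W)"
    by (simp add: Int_Un_distrib)
  finally have 1: "U \<inter> X interior_of (X closure_of (V \<union> W))
      \<subseteq> X interior_of (X closure_of (U \<inter> V \<union> U \<inter> W))"
    using op by (simp add: interior_of_maximal openin_Int)
  have "X interior_of (X closure_of (U \<inter> V \<union> U \<inter> W)) \<subseteq> X interior_of (X closure_of U)"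
    "X interior_of (X closure_of (U \<inter> V \<union> U \<inter> W)) \<subseteq> X interior_of (X closure_of (V \<union> W))"
    by (intro interior_of_mono closure_of_mono; blast)+
  then have 2: "X interior_of (X closure_of (U \<inter> V \<union> U \<inter> W))
      \<subseteq> U \<inter> X interior_of (X closure_of (V \<union> W))"
    using U by (auto simp: regular_openin_def)
  show ?thesis
    using 1 2 by (simp only: join_RO[OF V W] meet_RO[OF U V] meet_RO[OF U W] meet_RO[OF U VW]
        join_RO[OF UV UW] subset_antisym)
qed

lemma complement_RO:
  assumes "regular_openin X U"
  defines "V \<equiv> X interior_of (topspace X - U)"
  shows "regular_openin X V" "U \<sqinter>\<^bsub>RO X\<^esub> V = \<bottom>\<^bsub>RO X\<^esub>" "U \<squnion>\<^bsub>RO X\<^esub> V = \<top>\<^bsub>RO X\<^esub>"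
proof -
  have op: "openin X U" using assms by (simp add: regular_openin_def)
  then have "X closure_of (topspace X - U) = topspace X - U"
    by (simp add: closure_of_closedin openin_closedin_eq)
  then show V: "regular_openin X V"
    using regular_openin_int_cl[of X "topspace X - U"] by (simp add: V_def)
  show "U \<sqinter>\<^bsub>RO X\<^esub> V = \<bottom>\<^bsub>RO X\<^esub>"
    using interior_of_subset[of X "topspace X - U"]
    unfolding meet_RO[OF assms(1) V] bottom_RO by (auto simp: V_def)
  have "V = topspace X - X closure_of U"
    by (simp add: V_def interior_of_complement)
  moreover have "V \<subseteq> X closure_of V"
    by (simp add: V_def closure_of_subset interior_of_subset_topspace)
  ultimately have "X closure_of (U \<union> V) = topspace X"
    using closure_of_subset_topspace[of X "U \<union> V"] by (auto simp: closure_of_Un)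
  then show "U \<squnion>\<^bsub>RO X\<^esub> V = \<top>\<^bsub>RO X\<^esub>"
    by (simp add: join_RO[OF assms(1) V] top_RO)
qed

end

(* If the isolated points are dense, then RO X is the power set of Iso X. An irreducible Scott
   closed set F meets the open set of all a containing any given finite set of isolated points
   of its union. So F contains the directed family of these finite sets, and their supremum.

   Otherwise some nonempty regular open set R has no isolated points, and RO R is the Cohen
   algebra: it has a dense binary tree. Its two halves below the root make it a product B x B.
   The set F of all pairs of disjoint elements of B is Scott closed; it contains (1, 0) and
   (0, 1) but not (1, 1), so it is not principal. It is irreducible: let U and V be Scott open
   neighbourhoods of a and c in F. There are increasing sets Y n with dense union such that
   a - Y n stays in U for all n. As c Int Y n increases to c, it is in V for some n. The Y n can
   be chosen invariant under swapping the halves, and then the join of a - Y n and c Int Y n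
   is again in F. *)
theory Submission
  imports Defs "HOL-Library.Sublist"
begin

section \<open>Regular open sets\<close>

lemma regular_openin_openin: "regular_openin X U \<Longrightarrow> openin X U"
  by (simp add: regular_openin_def)

lemma regular_openin_maximal:
  assumes "regular_openin X U" "openin X W" "W \<subseteq> X closure_of U"
  shows "W \<subseteq> U"
  using assms by (metis interior_of_maximal regular_openin_def)

lemma int_cl_minimal:
  assumes "regular_openin X U" "S \<subseteq> U"
  shows "X interior_of (X closure_of S) \<subseteq> U"
  using assms by (metis closure_of_mono interior_of_mono regular_openin_def)

text \<open>This is the Boolean difference of \<open>a\<close> and the regularization of
  \<open>Y\<close>. The regularization \<open>?G\<close> stays below \<open>a\<close>, and being
  open it misses the closure of \<open>Y\<close> once it misses \<open>Y\<close>.\<close>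

lemma regular_openin_diff_closure:
  assumes a: "regular_openin X a" and Y: "openin X Y"
  shows "regular_openin X (a - X closure_of Y)"
proof -
  let ?G = "X interior_of (X closure_of (a - X closure_of Y))"
  have op: "openin X (a - X closure_of Y)"
    using a by (simp add: openin_diff regular_openin_openin)
  have "Y \<inter> (a - X closure_of Y) = {}"
    using closure_of_subset[OF openin_subset[OF Y]] by blast
  then have "Y \<inter> X closure_of (a - X closure_of Y) = {}"
    by (simp add: openin_Int_closure_of_eq_empty[OF Y])
  then have "?G \<inter> Y = {}"
    using interior_of_subset by fastforce
  then have "?G \<inter> X closure_of Y = {}"
    by (simp add: openin_Int_closure_of_eq_empty)
  moreover have "?G \<subseteq> a"
    using a by (rule int_cl_minimal) blast
  ultimately have "?G \<subseteq> a - X closure_of Y"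
    by blast
  then show ?thesis
    using op open_subset_int_cl[OF op] unfolding regular_openin_def by blast
qed

lemma open_nonempty_meets_closure_of:
  assumes "openin X W" "W \<noteq> {}" "W \<subseteq> X closure_of S"
  shows "W \<inter> S \<noteq> {}"
  using assms openin_Int_closure_of_eq_empty by fastforce

lemma open_subset_closure_ofI:
  assumes x: "openin X x"
    and meets: "\<And>W. openin X W \<Longrightarrow> W \<subseteq> x \<Longrightarrow> W \<noteq> {} \<Longrightarrow> W \<inter> S \<noteq> {}"
  shows "x \<subseteq> X closure_of S"
proof
  fix p assume p: "p \<in> x"
  have "\<exists>y. y \<in> S \<and> y \<in> T" if "p \<in> T" "openin X T" for T
    using meets[of "T \<inter> x"] that p x by (auto simp: openin_Int)
  then show "p \<in> X closure_of S"
    using p openin_subset[OF x] by (auto simp: in_closure_of)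
qed

lemma is_lub_RO_iff:
  assumes "D \<subseteq> carrier (RO X)"
  shows "is_lub (RO X) s D \<longleftrightarrow> s = X interior_of (X closure_of \<Union>D)"
  using is_lub_RO[OF assms] partial_order.least_unique[OF partial_order_RO] by blast

section \<open>Scott open and closed sets\<close>

lemma scott_open_upward:
  "scott_open P U \<Longrightarrow> x \<in> U \<Longrightarrow> y \<in> carrier P \<Longrightarrow> x \<sqsubseteq>\<^bsub>P\<^esub> y \<Longrightarrow> y \<in> U"
  unfolding scott_open_def by blast

lemma scott_open_RO_I:
  assumes "U \<subseteq> carrier (RO X)"
    and "\<And>x y. x \<in> U \<Longrightarrow> regular_openin X y \<Longrightarrow> x \<subseteq> y \<Longrightarrow> y \<in> U"
    and "\<And>D. directed_in (RO X) D \<Longrightarrow> X interior_of (X closure_of \<Union>D) \<in> U \<Longrightarrow> D \<inter> U \<noteq> {}"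
  shows "scott_open (RO X) U"
  unfolding scott_open_def
proof (intro conjI ballI allI impI)
  fix D s
  assume D: "directed_in (RO X) D \<and> is_lub (RO X) s D \<and> s \<in> U"
  then have "D \<subseteq> carrier (RO X)"
    by (simp add: directed_in_def)
  then have "s = X interior_of (X closure_of \<Union>D)"
    using D is_lub_RO_iff by blast
  then show "D \<inter> U \<noteq> {}"
    using D assms(3)[of D] by simp
qed (use assms in auto)

lemma scott_open_RO_directed:
  assumes "scott_open (RO X) U" "directed_in (RO X) D"
    "X interior_of (X closure_of \<Union>D) \<in> U"
  shows "D \<inter> U \<noteq> {}"
proof -
  have "D \<subseteq> carrier (RO X)"
    using assms(2) by (simp add: directed_in_def)
  then have "is_lub (RO X) (X interior_of (X closure_of \<Union>D)) D"
    by (rule is_lub_RO)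
  then show ?thesis
    using assms unfolding scott_open_def by metis
qed

text \<open>Density of the union in the regular open set \<open>x\<close> makes \<open>x\<close> the
  supremum of the sequence, so Scott openness applies.\<close>

lemma scott_open_RO_incseq:
  assumes U: "scott_open (RO X) U" "x \<in> U"
    and f: "\<And>n. regular_openin X (f n)" "incseq f" "\<And>n. f n \<subseteq> x"
    and dense: "x \<subseteq> X closure_of (\<Union>n. f n)"
  shows "\<exists>n. f n \<in> U"
proof -
  have x: "regular_openin X x"
    using U by (auto simp: scott_open_def)
  have "directed_in (RO X) (range f)"
    unfolding directed_in_def
  proof (intro conjI ballI)
    fix u v assume "u \<in> range f" "v \<in> range f"
    then obtain i j where "u = f i" "v = f j" by blast
    moreover have "f i \<subseteq> f (max i j)" "f j \<subseteq> f (max i j)"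
      using f(2) by (auto simp: incseq_def)
    ultimately show "\<exists>z\<in>range f. u \<sqsubseteq>\<^bsub>RO X\<^esub> z \<and> v \<sqsubseteq>\<^bsub>RO X\<^esub> z"
      by auto
  qed (use f in auto)
  moreover have "X interior_of (X closure_of (\<Union>n. f n)) = x"
    using int_cl_minimal[OF x, of "\<Union>n. f n"] f(3)
      interior_of_maximal[OF dense regular_openin_openin[OF x]] by blast
  ultimately have "range f \<inter> U \<noteq> {}"
    using scott_open_RO_directed[OF U(1)] U(2) by auto
  then show ?thesis by blast
qed

lemma closedin_scott_space:
  "closedin (scott_space P) C \<longleftrightarrow> C \<subseteq> carrier P \<and> scott_open P (carrier P - C)"
  by (simp add: closedin_def openin_scott_space topspace_scott_space)

lemma scott_closed_downward:
  assumes "closedin (scott_space P) C" "y \<in> C" "x \<in> carrier P" "x \<sqsubseteq>\<^bsub>P\<^esub> y"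
  shows "x \<in> C"
  using assms unfolding closedin_scott_space scott_open_def by blast

lemma scott_closed_RO_directed:
  assumes "closedin (scott_space (RO X)) C" "directed_in (RO X) D" "D \<subseteq> C"
  shows "X interior_of (X closure_of \<Union>D) \<in> C"
proof (rule ccontr)
  assume "\<not> ?thesis"
  then have "D \<inter> (carrier (RO X) - C) \<noteq> {}"
    using assms by (intro scott_open_RO_directed) (auto simp: closedin_scott_space regular_openin_int_cl)
  then show False
    using assms(3) by blast
qed

lemma closedin_scott_RO_below:
  assumes "regular_openin X m"
  shows "closedin (scott_space (RO X)) {a. regular_openin X a \<and> a \<subseteq> m}"
  unfolding closedin_scott_space
proof
  show "scott_open (RO X) (carrier (RO X) - {a. regular_openin X a \<and> a \<subseteq> m})"
  proof (rule scott_open_RO_I)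
    fix D
    assume D: "directed_in (RO X) D"
      and "X interior_of (X closure_of \<Union>D) \<in> carrier (RO X) - {a. regular_openin X a \<and> a \<subseteq> m}"
    then have "\<not> \<Union>D \<subseteq> m"
      using int_cl_minimal[OF assms, of "\<Union>D"] by auto
    then show "D \<inter> (carrier (RO X) - {a. regular_openin X a \<and> a \<subseteq> m}) \<noteq> {}"
      using D unfolding directed_in_def by auto
  qed auto
qed auto

text \<open>Turns sobriety of the Scott space into the question whether irreducible closed sets are
  principal ideals.\<close>

lemma scott_closure_of_singleton_RO:
  assumes m: "regular_openin X m"
  shows "scott_space (RO X) closure_of {m} = {a. regular_openin X a \<and> a \<subseteq> m}"
proof (rule closure_of_unique)
  fix T assume "{m} \<subseteq> T" "closedin (scott_space (RO X)) T"
  then show "{a. regular_openin X a \<and> a \<subseteq> m} \<subseteq> T"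
    using scott_closed_downward[of "RO X" T m] by auto
qed (use m closedin_scott_RO_below[OF m] in auto)

lemma t0_scott_space_RO: "t0_space (scott_space (RO X))"
  unfolding t0_space_closure_of_sing topspace_scott_space
  by (auto simp: scott_closure_of_singleton_RO)

lemma irreducible_in_Int_open:
  assumes "irreducible_in T F" "openin T U" "openin T V" "F \<inter> U \<noteq> {}" "F \<inter> V \<noteq> {}"
  shows "F \<inter> (U \<inter> V) \<noteq> {}"
proof
  assume "F \<inter> (U \<inter> V) = {}"
  then have "F \<subseteq> (topspace T - U) \<union> (topspace T - V)"
    using assms(1) unfolding irreducible_in_def by blast
  then have "F \<subseteq> topspace T - U \<or> F \<subseteq> topspace T - V"
    using assms unfolding irreducible_in_def by (meson closedin_diff closedin_topspace)
  then show False
    using assms(4,5) by blast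
qed

text \<open>Passes to the complements of the closed sets. The points \<open>a\<close> and
  \<open>c\<close> are kept because a common point will be built from them.\<close>

lemma irreducible_inI:
  assumes "F \<subseteq> topspace T" "F \<noteq> {}"
    and "\<And>U V a c. openin T U \<Longrightarrow> openin T V \<Longrightarrow> a \<in> F \<inter> U \<Longrightarrow> c \<in> F \<inter> V \<Longrightarrow> F \<inter> (U \<inter> V) \<noteq> {}"
  shows "irreducible_in T F"
  unfolding irreducible_in_def
proof (intro conjI allI impI)
  fix C1 C2
  assume C: "closedin T C1 \<and> closedin T C2 \<and> F \<subseteq> C1 \<union> C2"
  show "F \<subseteq> C1 \<or> F \<subseteq> C2"
  proof (rule ccontr)
    assume "\<not> ?thesis"
    then obtain a c where "a \<in> F \<inter> (topspace T - C1)" "c \<in> F \<inter> (topspace T - C2)"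
      using assms(1) by blast
    then have "F \<inter> ((topspace T - C1) \<inter> (topspace T - C2)) \<noteq> {}"
      using C by (intro assms(3)) (auto simp: openin_diff)
    then show False
      using C by blast
  qed
qed (use assms in auto)

section \<open>Dense isolated points\<close>

text \<open>With \<open>X\<close> Hausdorff, this set has no atom below it; if nonempty, it will be
  the root of the tree.\<close>

lemma regular_openin_complement_Iso:
  "regular_openin X (topspace X - X closure_of (Iso X))"
proof (rule regular_openin_diff_closure)
  show "openin X (Iso X)"
    using openin_subopen[of X "Iso X"] by (fastforce simp: Iso_def)
qed (simp add: regular_openin_def)

lemma sober_scott_RO_if_Iso_dense:
  assumes dense: "X closure_of (Iso X) = topspace X"
  shows "sober_space (scott_space (RO X))"
  unfolding sober_space_def
proof (intro conjI allI impI t0_scott_space_RO)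
  fix F
  assume "closedin (scott_space (RO X)) F \<and> irreducible_in (scott_space (RO X)) F"
  then have cl: "closedin (scott_space (RO X)) F" and irr: "irreducible_in (scott_space (RO X)) F"
    by auto
  have FR: "regular_openin X f" if "f \<in> F" for f
    using cl that by (auto simp: closedin_scott_space)
  \<comment> \<open>An isolated point in the closure of a union lies in the union itself, because
    its singleton is an open neighbourhood.\<close>
  have point_open: "openin (scott_space (RO X)) {a. regular_openin X a \<and> x \<in> a}" if "x \<in> Iso X" for x
    unfolding openin_scott_space
  proof (rule scott_open_RO_I)
    fix D
    assume D: "directed_in (RO X) D"
      and "X interior_of (X closure_of \<Union>D) \<in> {a. regular_openin X a \<and> x \<in> a}"
    then have "x \<in> X closure_of \<Union>D"
      using interior_of_subset by fastforce
    moreover have "openin X {x}"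
      using that by (simp add: Iso_def)
    ultimately have "x \<in> \<Union>D"
      by (auto simp: in_closure_of)
    then show "D \<inter> {a. regular_openin X a \<and> x \<in> a} \<noteq> {}"
      using D unfolding directed_in_def by auto
  qed auto
  have common: "\<exists>f\<in>F. S \<subseteq> f" if "finite S" "S \<subseteq> Iso X \<inter> \<Union>F" for S
  proof -
    \<comment> \<open>Openness is part of the induction claim because irreducibility needs it to
      pass from \<open>S\<close> to \<open>insert x S\<close>.\<close>
    have "openin (scott_space (RO X)) {a. regular_openin X a \<and> S \<subseteq> a} \<and> (\<exists>f\<in>F. S \<subseteq> f)"
      using that
    proof (induction S rule: finite_induct)
      case empty
      have "openin (scott_space (RO X)) (carrier (RO X))"
        by (metis openin_topspace topspace_scott_space)
      then show ?case
        using irr by (auto simp: irreducible_in_def)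
    next
      case (insert x S)
      let ?U = "{a. regular_openin X a \<and> x \<in> a}" and ?V = "{a. regular_openin X a \<and> S \<subseteq> a}"
      have U: "openin (scott_space (RO X)) ?U"
        using insert.prems by (auto intro: point_open)
      have V: "openin (scott_space (RO X)) ?V" and "F \<inter> ?V \<noteq> {}"
        using insert FR by auto
      moreover have "F \<inter> ?U \<noteq> {}"
        using insert.prems FR by blast
      ultimately have "F \<inter> (?U \<inter> ?V) \<noteq> {}"
        using irreducible_in_Int_open[OF irr U] by blast
      moreover have "?U \<inter> ?V = {a. regular_openin X a \<and> insert x S \<subseteq> a}"
        by blast
      ultimately show ?case
        using openin_Int[OF U V] by auto
    qed
    then show ?thesis by blast
  qed
  let ?h = "\<lambda>S. X interior_of (X closure_of S)"
  let ?D = "?h ` {S. finite S \<and> S \<subseteq> Iso X \<inter> \<Union>F}"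
  let ?m = "?h (\<Union>?D)"
  have "?D \<subseteq> F"
  proof clarify
    fix S assume "finite S" "S \<subseteq> Iso X \<inter> \<Union>F"
    then obtain f where "f \<in> F" "S \<subseteq> f"
      using common by blast
    then show "?h S \<in> F"
      using scott_closed_downward[OF cl, of f "?h S"] int_cl_minimal[OF FR, of f S]
      by (simp add: regular_openin_int_cl)
  qed
  moreover have "directed_in (RO X) ?D"
    unfolding directed_in_def
  proof (intro conjI ballI)
    fix u v assume "u \<in> ?D" "v \<in> ?D"
    then obtain S T where "u = ?h S" "v = ?h T"
      "finite S" "S \<subseteq> Iso X \<inter> \<Union>F" "finite T" "T \<subseteq> Iso X \<inter> \<Union>F"
      by blast
    moreover have "?h S \<subseteq> ?h (S \<union> T)" "?h T \<subseteq> ?h (S \<union> T)"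
      by (intro interior_of_mono closure_of_mono; blast)+
    ultimately show "\<exists>z\<in>?D. u \<sqsubseteq>\<^bsub>RO X\<^esub> z \<and> v \<sqsubseteq>\<^bsub>RO X\<^esub> z"
      by (intro bexI[of _ "?h (S \<union> T)"]) (auto simp del: closure_of_Un)
  qed (auto simp: regular_openin_int_cl)
  ultimately have mF: "?m \<in> F"
    using cl by (intro scott_closed_RO_directed)
  \<comment> \<open>Singletons of isolated points are among the finite sets behind
    \<open>?D\<close>, so \<open>?m\<close> meets every nonempty open part of \<open>f\<close>;
    regularity of \<open>?m\<close> then gives the inclusion.\<close>
  have below: "f \<subseteq> ?m" if f: "f \<in> F" for f
  proof (rule regular_openin_maximal)
    show "f \<subseteq> X closure_of ?m"
    proof (rule open_subset_closure_ofI)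
      show "openin X f"
        using FR f regular_openin_openin by blast
      fix W assume W: "openin X W" "W \<subseteq> f" "W \<noteq> {}"
      then have "W \<inter> Iso X \<noteq> {}"
        using dense by (intro open_nonempty_meets_closure_of) (auto dest: openin_subset)
      then obtain x where x: "x \<in> W" "x \<in> Iso X" by blast
      then have "openin X {x}"
        by (simp add: Iso_def)
      then have "x \<in> ?h {x}"
        using open_subset_int_cl by blast
      moreover have "?h {x} \<in> ?D"
        using x W f by blast
      moreover have "openin X (\<Union>?D)"
        by auto
      ultimately have "x \<in> ?m"
        using open_subset_int_cl[of X "\<Union>?D"] by blast
      then show "W \<inter> ?m \<noteq> {}"
        using x by blast
    qed
  qed (use FR f regular_openin_openin regular_openin_int_cl in blast)+
  have "F = {a. regular_openin X a \<and> a \<subseteq> ?m}"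
  proof (intro equalityI subsetI)
    fix a assume "a \<in> {a. regular_openin X a \<and> a \<subseteq> ?m}"
    then show "a \<in> F"
      using scott_closed_downward[OF cl mF, of a] by simp
  qed (use below FR in blast)
  then show "\<exists>x\<in>topspace (scott_space (RO X)). F = scott_space (RO X) closure_of {x}"
    by (intro bexI[of _ ?m])
      (auto simp: scott_closure_of_singleton_RO regular_openin_int_cl topspace_scott_space)
qed

text \<open>The atoms of \<open>RO X\<close> for Hausdorff \<open>X\<close> are the open singletons:
  two points of an atom would have disjoint neighbourhoods, and these would cut the atom into
  smaller regular open sets.\<close>

lemma atomic_RO_iff_Iso_dense:
  assumes X: "Hausdorff_space X"
  shows "atomic_order (RO X) \<longleftrightarrow> X closure_of (Iso X) = topspace X"
proof
  assume at: "atomic_order (RO X)"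
  let ?O = "topspace X - X closure_of (Iso X)"
  show "X closure_of (Iso X) = topspace X"
  proof (rule ccontr)
    assume "\<not> ?thesis"
    then have "?O \<noteq> {}"
      using closure_of_subset_topspace[of X "Iso X"] by blast
    then obtain a where a: "atom_in (RO X) a" "a \<subseteq> ?O"
      using at regular_openin_complement_Iso[of X] unfolding atomic_order_def bottom_RO by auto
    then have aR: "regular_openin X a" and "a \<noteq> {}"
      by (auto simp: atom_in_def bottom_RO)
    then obtain x where x: "x \<in> a" by blast
    have "a \<noteq> {x}"
      using a x aR closure_of_subset[of "Iso X" X] by (auto simp: Iso_def regular_openin_def)
    then obtain y where y: "y \<in> a" "y \<noteq> x"
      using x by blast
    have top: "x \<in> topspace X" "y \<in> topspace X"
      using x y aR by (meson in_mono openin_subset regular_openin_openin)+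
    then obtain G H where GH: "openin X G" "openin X H" "x \<in> G" "y \<in> H" "disjnt G H"
      using X y(2) unfolding Hausdorff_space_def by metis
    \<comment> \<open>\<open>?b\<close> is nonzero and below the atom \<open>a\<close>, yet the
      neighbourhood \<open>H\<close> keeps \<open>y\<close> out of the closure of
      \<open>G \<inter> a\<close>.\<close>
    let ?b = "X interior_of (X closure_of (G \<inter> a))"
    have "openin X (G \<inter> a)"
      using GH aR by (simp add: openin_Int regular_openin_openin)
    then have "x \<in> ?b"
      using x GH open_subset_int_cl by blast
    moreover have "?b \<subseteq> a"
      using aR by (rule int_cl_minimal) blast
    ultimately have "?b = a"
      using a(1) regular_openin_int_cl[of X "G \<inter> a"]
      unfolding atom_in_def bottom_RO by auto
    then have "y \<in> X closure_of (G \<inter> a)"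
      using y interior_of_subset by fastforce
    then show False
      using GH by (auto simp: in_closure_of disjnt_def)
  qed
next
  assume dense: "X closure_of (Iso X) = topspace X"
  show "atomic_order (RO X)"
    unfolding atomic_order_def bottom_RO
  proof (intro ballI impI)
    fix b assume b: "b \<in> carrier (RO X)" "b \<noteq> {}"
    then have "b \<inter> Iso X \<noteq> {}"
      using dense by (intro open_nonempty_meets_closure_of)
        (auto dest: openin_subset simp: regular_openin_def)
    then obtain x where x: "x \<in> b" "x \<in> topspace X" "openin X {x}"
      by (auto simp: Iso_def)
    moreover have "closedin X {x}"
      using X x(2) by (simp add: closedin_Hausdorff_singleton)
    ultimately have "regular_openin X {x}"
      by (simp add: regular_openin_def closure_of_closedin interior_of_openin)
    then have "atom_in (RO X) {x}"
      by (auto simp: atom_in_def bottom_RO)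
    then show "\<exists>a. atom_in (RO X) a \<and> a \<sqsubseteq>\<^bsub>RO X\<^esub> b"
      using x by auto
  qed
qed

section \<open>Dense binary trees of open sets\<close>

text \<open>Nodes are listed from the leaf to the root: the children of \<open>s\<close> are \<open>b # s\<close>, and
  the descendants of \<open>s\<close> are the lists with suffix \<open>s\<close>.\<close>

locale dense_binary_tree =
  fixes X :: "'a topology" and A :: "bool list \<Rightarrow> 'a set"
  assumes regular_root: "regular_openin X (A [])"
    and open_node: "openin X (A s)"
    and nonempty_node: "A s \<noteq> {}"
    and child_subset: "A (b # s) \<subseteq> A s"
    and disjoint_children: "A (True # s) \<inter> A (False # s) = {}"
    and dense: "openin X W \<Longrightarrow> W \<inter> A [] \<noteq> {} \<Longrightarrow> \<exists>s. A s \<subseteq> W"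
begin

section \<open>Comparability and density of nodes\<close>

lemma append_subset: "A (t @ s) \<subseteq> A s"
  by (induction t) (use child_subset in auto)

lemma subset_root: "A s \<subseteq> A []"
  using append_subset[of s "[]"] by simp

text \<open>Induction from the leaf end. If \<open>t\<close> lies properly below the parent
  \<open>s\<close>, it passes through some child \<open>c # s\<close>, and disjointness of siblings
  forces \<open>c = b\<close>.\<close>

lemma comparable_if_meet:
  assumes "A s \<inter> A t \<noteq> {}"
  shows "suffix s t \<or> suffix t s"
  using assms
proof (induction s)
  case (Cons b s)
  then consider "suffix s t" | "suffix t s"
    using child_subset[of b s] by blast
  then show ?case
  proof cases
    case 1
    then obtain u where u: "t = u @ s"
      by (auto simp: suffix_def)
    show ?thesis
    proof (cases u rule: rev_cases)
      case Nil
      then show ?thesis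
        using u by (simp add: suffix_ConsI)
    next
      case (snoc v c)
      then have "A t \<subseteq> A (c # s)"
        using u append_subset[of v "c # s"] by simp
      then have "A (b # s) \<inter> A (c # s) \<noteq> {}"
        using Cons.prems by blast
      then have "b = c"
        using disjoint_children[of s] by (cases b; cases c) auto
      then show ?thesis
        using u snoc by (simp add: suffix_def)
    qed
  qed (simp add: suffix_ConsI)
qed simp

lemma meet_if_comparable:
  assumes "suffix s t \<or> suffix t s"
  shows "A s \<inter> A t \<noteq> {}"
  using assms append_subset nonempty_node unfolding suffix_def by blast

text \<open>Density yields a node inside \<open>A s \<inter> W\<close>. As it meets
  \<open>A s\<close>, it is comparable with \<open>s\<close>; if it is an ancestor,
  \<open>A s\<close> itself lies in \<open>W\<close>.\<close>

lemma extend_into: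
  assumes W: "openin X W" "A s \<inter> W \<noteq> {}"
  shows "\<exists>t. A (t @ s) \<subseteq> W"
proof -
  have "A s \<inter> W \<inter> A [] \<noteq> {}"
    using W subset_root by blast
  then obtain u where u: "A u \<subseteq> A s \<inter> W"
    using dense[of "A s \<inter> W"] W open_node by auto
  then have "A u \<inter> A s \<noteq> {}"
    using nonempty_node by blast
  then consider "suffix u s" | "suffix s u"
    using comparable_if_meet by blast
  then show ?thesis
  proof cases
    case 1
    then have "A s \<subseteq> A u"
      using append_subset unfolding suffix_def by blast
    then show ?thesis
      using u by (intro exI[of _ "[]"]) auto
  qed (use u in \<open>auto simp: suffix_def\<close>)
qed

lemma extend_into_member:
  assumes "\<And>d. d \<in> D \<Longrightarrow> openin X d" "A s \<subseteq> X closure_of \<Union>D"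
  shows "\<exists>t. \<exists>d\<in>D. A (t @ s) \<subseteq> d"
proof -
  have "A s \<inter> \<Union>D \<noteq> {}"
    using assms open_node nonempty_node by (intro open_nonempty_meets_closure_of)
  then show ?thesis
    using assms(1) extend_into by blast
qed

lemma subset_closure_ofI:
  assumes x: "openin X x" "x \<subseteq> A []" and meets: "\<And>s. A s \<subseteq> x \<Longrightarrow> A s \<inter> S \<noteq> {}"
  shows "x \<subseteq> X closure_of S"
proof (rule open_subset_closure_ofI[OF x(1)])
  fix W assume W: "openin X W" "W \<subseteq> x" "W \<noteq> {}"
  then obtain s where "A s \<subseteq> W"
    using dense[of W] x(2) by blast
  then show "W \<inter> S \<noteq> {}"
    using meets[of s] W(2) by blast
qed

section \<open>A Scott closed set that is not a principal ideal\<close>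

text \<open>\<open>twin a\<close>: identifying the two halves of the tree with each other, \<open>a\<close> contains
  overlapping parts of both.\<close>

definition twin :: "'a set \<Rightarrow> bool" where
  "twin a \<longleftrightarrow> (\<exists>s. A (s @ [True]) \<subseteq> a \<and> A (s @ [False]) \<subseteq> a)"

text \<open>With a part of the root seen as a pair, one component per half, this is the set of
  disjoint pairs.\<close>

definition untwinned :: "'a set set" where
  "untwinned = {a. regular_openin X a \<and> a \<subseteq> A [] \<and> \<not> twin a}"

lemma twin_mono: "twin a \<Longrightarrow> a \<subseteq> b \<Longrightarrow> twin b"
  unfolding twin_def by blast

text \<open>The common address is extended twice: first until the \<open>True\<close> copy enters
  some \<open>d\<close>, then until the \<open>False\<close> copy enters some \<open>e\<close>.
  Shrinking keeps the first inclusion, so one address \<open>w\<close> serves both.\<close>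

lemma twin_extend_into_members:
  assumes D: "\<And>d. d \<in> D \<Longrightarrow> openin X d" and twin: "twin a" "a \<subseteq> X closure_of \<Union>D"
  shows "\<exists>w. \<exists>d\<in>D. \<exists>e\<in>D. A (w @ [True]) \<subseteq> d \<and> A (w @ [False]) \<subseteq> e"
proof -
  obtain s where s: "A (s @ [True]) \<subseteq> a" "A (s @ [False]) \<subseteq> a"
    using twin unfolding twin_def by blast
  obtain t d where t: "d \<in> D" "A (t @ s @ [True]) \<subseteq> d"
    using extend_into_member[of D "s @ [True]"] D s(1) twin(2) by blast
  have "A (t @ s @ [False]) \<subseteq> X closure_of \<Union>D"
    using append_subset[of t "s @ [False]"] s(2) twin(2) by blast
  then obtain v e where v: "e \<in> D" "A (v @ t @ s @ [False]) \<subseteq> e"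
    using extend_into_member[of D "t @ s @ [False]"] D by blast
  have "A (v @ t @ s @ [True]) \<subseteq> d"
    using append_subset[of v "t @ s @ [True]"] t(2) by blast
  then show ?thesis
    using t(1) v by (intro exI[of _ "v @ t @ s"]) auto
qed

text \<open>A twin supremum yields two nodes inside two members of \<open>D\<close>; directedness
  puts both into one member, which is then twin.\<close>

lemma closedin_untwinned: "closedin (scott_space (RO X)) untwinned"
  unfolding closedin_scott_space
proof
  show "scott_open (RO X) (carrier (RO X) - untwinned)"
  proof (rule scott_open_RO_I)
    fix D
    assume D: "directed_in (RO X) D"
      and lub: "X interior_of (X closure_of \<Union>D) \<in> carrier (RO X) - untwinned"
    have DR: "regular_openin X d" if "d \<in> D" for d
      using D that unfolding directed_in_def by auto
    show "D \<inter> (carrier (RO X) - untwinned) \<noteq> {}"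
    proof
      assume "D \<inter> (carrier (RO X) - untwinned) = {}"
      then have Du: "d \<subseteq> A []" "\<not> twin d" if "d \<in> D" for d
        using that DR by (auto simp: untwinned_def)
      have "X interior_of (X closure_of \<Union>D) \<subseteq> A []"
        using Du by (intro int_cl_minimal[OF regular_root]) auto
      then have "twin (X interior_of (X closure_of \<Union>D))"
        using lub by (auto simp: untwinned_def)
      then obtain w d e where w: "d \<in> D" "e \<in> D" "A (w @ [True]) \<subseteq> d" "A (w @ [False]) \<subseteq> e"
        using twin_extend_into_members[of D] DR regular_openin_openin interior_of_subset by metis
      then obtain z where "z \<in> D" "d \<subseteq> z" "e \<subseteq> z"
        using D unfolding directed_in_def le_RO by blast
      then have "twin z"
        using w unfolding twin_def by blast
      then show False
        using Du \<open>z \<in> D\<close> by blast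
    qed
  next
    fix x y
    assume "x \<in> carrier (RO X) - untwinned" "regular_openin X y" "x \<subseteq> y"
    then show "y \<in> carrier (RO X) - untwinned"
      using twin_mono[of x y] by (auto simp: untwinned_def)
  qed auto
qed (auto simp: untwinned_def)

text \<open>Every node in the other half is disjoint from \<open>A [b]\<close>, hence from its
  closure.\<close>

lemma half_untwinned: "X interior_of (X closure_of (A [b])) \<in> untwinned"
proof -
  have "A (s @ [\<not> b]) \<inter> X closure_of (A [b]) = {}" for s
  proof -
    have "A (s @ [\<not> b]) \<inter> A [b] = {}"
      using comparable_if_meet[of "s @ [\<not> b]" "[b]"] by (auto simp: suffix_def append_eq_Cons_conv)
    then show ?thesis
      using openin_Int_closure_of_eq_empty open_node by blast
  qed
  then have "\<not> A (s @ [\<not> b]) \<subseteq> X interior_of (X closure_of (A [b]))" for s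
    using nonempty_node[of "s @ [\<not> b]"] interior_of_subset[of X "X closure_of (A [b])"] by blast
  then have "\<not> twin (X interior_of (X closure_of (A [b])))"
    unfolding twin_def by (metis (full_types))
  then show ?thesis
    using int_cl_minimal[OF regular_root subset_root]
    by (simp add: untwinned_def regular_openin_int_cl)
qed

text \<open>A greatest element would contain both halves, which are twins at the empty
  address.\<close>

lemma untwinned_not_principal:
  assumes m: "regular_openin X m"
  shows "untwinned \<noteq> {a. regular_openin X a \<and> a \<subseteq> m}"
proof
  assume eq: "untwinned = {a. regular_openin X a \<and> a \<subseteq> m}"
  have "A [b] \<subseteq> m" for b
    using half_untwinned[of b] open_subset_int_cl[OF open_node[of "[b]"]] eq by blast
  then have "twin m"
    unfolding twin_def by (intro exI[of _ "[]"]) simp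
  then show False
    using m eq by (auto simp: untwinned_def)
qed

section \<open>Symmetric open sets with dense union\<close>

text \<open>The branches that turn \<^term>\<open>False\<close> at each of the positions \<open>n, \<dots>, n + k - 1\<close>.\<close>

definition zeros :: "nat \<Rightarrow> nat \<Rightarrow> 'a set" where
  "zeros n k = (\<Union>s\<in>{s. length s = n}. A (replicate k False @ s))"

lemma openin_zeros: "openin X (zeros n k)"
  unfolding zeros_def using open_node by blast

lemma zeros_Suc_subset: "zeros n (Suc k) \<subseteq> zeros n k"
  unfolding zeros_def using child_subset by fastforce

text \<open>Positions are counted from the root, starting at \<open>0\<close>. The branch
  \<open>True # s\<close> turns \<open>True\<close> at position \<open>length s\<close>, which lies
  in the range \<open>n, ..., n + m - 1\<close> of forced \<open>False\<close> turns.\<close>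

lemma zeros_disjoint:
  assumes "length s \<ge> n" and "m > length s - n"
  shows "A (True # s) \<inter> zeros n m = {}"
proof (rule ccontr)
  assume "\<not> ?thesis"
  then obtain v where v: "length v = n" "A (True # s) \<inter> A (replicate m False @ v) \<noteq> {}"
    unfolding zeros_def by blast
  have "length (replicate m False @ v) \<ge> length (True # s)"
    using assms v(1) by auto
  then obtain w where w: "replicate m False @ v = w @ True # s"
    using comparable_if_meet[OF v(2)] unfolding suffix_def by fastforce
  \<comment> \<open>The index \<open>length w\<close> selects \<open>True\<close> on the right-hand
    side of \<open>w\<close>, but falls inside the \<open>replicate\<close> block on the left-hand
    side.\<close>
  have "length w < m"
    using arg_cong[OF w, of length] assms(1) v(1) by simp
  then have "(replicate m False @ v) ! length w = False"
    by (simp add: nth_append)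
  then show False
    unfolding w by simp
qed

text \<open>For fixed \<open>n\<close> the sets \<open>zeros n k\<close> shrink as \<open>k\<close>
  grows, and every node has a descendant that misses one of them. So the differences increase to
  \<open>a\<close>.\<close>

lemma zeros_decreasing_to_empty:
  assumes U: "scott_open (RO X) U" "a \<in> U" and a: "a \<subseteq> A []"
  shows "\<exists>k. a - X closure_of (zeros n k) \<in> U"
proof (rule scott_open_RO_incseq[OF U])
  have aR: "regular_openin X a"
    using U by (auto simp: scott_open_def)
  then show "regular_openin X (a - X closure_of (zeros n k))" for k
    using openin_zeros by (rule regular_openin_diff_closure)
  show "incseq (\<lambda>k. a - X closure_of (zeros n k))"
    using closure_of_mono[OF zeros_Suc_subset] by (intro incseq_SucI) blast
  show "a \<subseteq> X closure_of (\<Union>k. a - X closure_of (zeros n k))"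
  proof (rule subset_closure_ofI[OF regular_openin_openin[OF aR] a])
    fix s assume s: "A s \<subseteq> a"
    \<comment> \<open>Padding by \<open>n\<close> turns makes \<open>length t\<close> at least
      \<open>n\<close>, as \<open>zeros_disjoint\<close> requires, even if \<open>s\<close> is
      short.\<close>
    define t where "t = replicate n True @ s"
    have "A (True # t) \<inter> zeros n (Suc (length t)) = {}"
      by (intro zeros_disjoint) (auto simp: t_def)
    then have "A (True # t) \<inter> X closure_of (zeros n (Suc (length t))) = {}"
      by (simp add: openin_Int_closure_of_eq_empty open_node)
    moreover have "A (True # t) \<subseteq> A s"
      using append_subset[of "True # replicate n True" s] by (simp add: t_def)
    ultimately show "A s \<inter> (\<Union>k. a - X closure_of (zeros n k)) \<noteq> {}"
      using nonempty_node[of "True # t"] s by blast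
  qed
qed auto

text \<open>Level \<open>0\<close> is excluded so that membership in a \<open>symmetric\<close> set does not depend on the
  half of the tree.\<close>

definition symmetric :: "'a set \<Rightarrow> bool" where
  "symmetric Y \<longleftrightarrow> openin X Y \<and>
    (\<forall>w b. A (w @ [b]) \<inter> Y \<noteq> {} \<longrightarrow> A (w @ [\<not> b]) \<inter> Y \<noteq> {})"

lemma symmetric_empty: "symmetric {}"
  by (simp add: symmetric_def)

lemma symmetric_Un:
  assumes "symmetric Y" "symmetric Z"
  shows "symmetric (Y \<union> Z)"
  using assms unfolding symmetric_def by (simp add: Int_Un_distrib openin_Un) blast

text \<open>The first turn \<open>c\<close> of an address of length \<open>Suc n\<close> is
  unrestricted. Comparable nonempty addresses share their first turn, and flipping it in both keeps
  them comparable.\<close>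

lemma symmetric_zeros: "symmetric (zeros (Suc n) k)"
  unfolding symmetric_def
proof (intro conjI allI impI openin_zeros)
  fix w b
  assume "A (w @ [b]) \<inter> zeros (Suc n) k \<noteq> {}"
  then obtain s where s: "length s = Suc n" "A (w @ [b]) \<inter> A (replicate k False @ s) \<noteq> {}"
    unfolding zeros_def by blast
  then obtain r c where r: "s = r @ [c]"
    by (cases s rule: rev_cases) auto
  let ?u = "replicate k False @ r"
  have "suffix (w @ [b]) (?u @ [c]) \<or> suffix (?u @ [c]) (w @ [b])"
    using comparable_if_meet[OF s(2)] r by simp
  then have "suffix (w @ [\<not> b]) (?u @ [\<not> b]) \<or> suffix (?u @ [\<not> b]) (w @ [\<not> b])"
    unfolding snoc_suffix_snoc by blast
  then have "A (w @ [\<not> b]) \<inter> A (replicate k False @ r @ [\<not> b]) \<noteq> {}"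
    using meet_if_comparable[of "w @ [\<not> b]" "?u @ [\<not> b]"] by simp
  moreover have "length (r @ [\<not> b]) = Suc n"
    using s(1) r by simp
  ultimately show "A (w @ [\<not> b]) \<inter> zeros (Suc n) k \<noteq> {}"
    unfolding zeros_def by blast
qed

text \<open>Removing \<open>zeros n k\<close> for large \<open>k\<close> costs \<open>a\<close> arbitrarily little, so Scott openness
  allows one such removal for every \<open>n\<close> in turn; yet the union of the removed sets is dense.\<close>

lemma symmetric_exhausting_sequence:
  assumes U: "scott_open (RO X) U" "a \<in> U" and a: "a \<subseteq> A []"
  obtains Y where "\<And>n. symmetric (Y n)" "\<And>n. a - X closure_of (Y n) \<in> U" "incseq Y"
    "\<And>s. A s \<inter> (\<Union>n. Y n) \<noteq> {}"
proof -
  have "\<exists>Y. \<forall>n. (symmetric (Y n) \<and> a - X closure_of (Y n) \<in> U) \<and>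
      (\<exists>k. Y (Suc n) = Y n \<union> zeros (Suc n) k)"
  proof (rule dependent_nat_choice)
    show "\<exists>Y. symmetric Y \<and> a - X closure_of Y \<in> U"
      using symmetric_empty U by (intro exI[of _ "{}"]) simp
  next
    fix Y n
    assume Y: "symmetric Y \<and> a - X closure_of Y \<in> U"
    then obtain k where "a - X closure_of Y - X closure_of (zeros (Suc n) k) \<in> U"
      using zeros_decreasing_to_empty[OF U(1), of "a - X closure_of Y" "Suc n"] a by blast
    then have "a - X closure_of (Y \<union> zeros (Suc n) k) \<in> U"
      by (simp add: closure_of_Un Diff_Un Int_Diff set_diff_eq conj_ac)
    then show "\<exists>Y'. (symmetric Y' \<and> a - X closure_of Y' \<in> U) \<and> (\<exists>k. Y' = Y \<union> zeros (Suc n) k)"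
      using Y symmetric_Un symmetric_zeros by blast
  qed
  then obtain Y where Y: "\<And>n. symmetric (Y n)" "\<And>n. a - X closure_of (Y n) \<in> U"
    "\<And>n. \<exists>k. Y (Suc n) = Y n \<union> zeros (Suc n) k"
    by blast
  show thesis
  proof
    show "incseq Y"
      using Y(3) by (intro incseq_SucI) blast
    fix s :: "bool list"
    let ?n = "length s"
    obtain k where "zeros (Suc ?n) k \<subseteq> Y (Suc ?n)"
      using Y(3)[of ?n] by blast
    \<comment> \<open>Whatever \<open>k\<close> was chosen, continuing from \<open>s\<close> with
      \<open>False\<close> turns leads into the set added at level \<open>Suc ?n\<close>.\<close>
    moreover have "A (replicate k False @ False # s) \<subseteq> zeros (Suc ?n) k"
      unfolding zeros_def by (rule UN_upper) simp
    moreover have "A (replicate k False @ False # s) \<subseteq> A s"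
      using append_subset[of "replicate k False @ [False]" s] by simp
    ultimately have "A (replicate k False @ False # s) \<subseteq> A s \<inter> (\<Union>n. Y n)"
      by blast
    then show "A s \<inter> (\<Union>n. Y n) \<noteq> {}"
      using nonempty_node[of "replicate k False @ False # s"] by blast
  qed (use Y in auto)
qed

text \<open>Twin nodes of the join can be pushed into the two pieces. If both land in the same
  piece, \<open>a\<close> or \<open>c\<close> is twin. Otherwise the node inside \<open>Y\<close>
  has, by symmetry, a partner meeting \<open>Y\<close>, yet that partner avoids the closure of
  \<open>Y\<close>.\<close>

lemma not_twin_symmetric_mix:
  assumes a: "regular_openin X a" "\<not> twin a" and c: "regular_openin X c" "\<not> twin c"
    and Y: "symmetric Y"
  shows "\<not> twin (X interior_of (X closure_of ((a - X closure_of Y) \<union> (c \<inter> Y))))"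
proof
  let ?D = "{a - X closure_of Y, c \<inter> Y}"
  have Yo: "openin X Y"
    using Y by (simp add: symmetric_def)
  assume "twin (X interior_of (X closure_of ((a - X closure_of Y) \<union> (c \<inter> Y))))"
  moreover have "openin X d" if "d \<in> ?D" for d
    using that a c Yo by (auto simp: openin_diff openin_Int regular_openin_openin)
  moreover have "X interior_of (X closure_of ((a - X closure_of Y) \<union> (c \<inter> Y)))
      \<subseteq> X closure_of \<Union>?D"
    by (simp add: interior_of_subset)
  ultimately obtain w d e
    where w: "d \<in> ?D" "e \<in> ?D" "A (w @ [True]) \<subseteq> d" "A (w @ [False]) \<subseteq> e"
    using twin_extend_into_members[of ?D] by meson
  have mixed: False if "A (w @ [b]) \<subseteq> a - X closure_of Y" "A (w @ [\<not> b]) \<subseteq> c \<inter> Y" for b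
  proof -
    have "A (w @ [\<not> b]) \<inter> Y \<noteq> {}"
      using that(2) nonempty_node[of "w @ [\<not> b]"] by blast
    then have "A (w @ [\<not> \<not> b]) \<inter> Y \<noteq> {}"
      using Y unfolding symmetric_def by blast
    then show False
      using that(1) closure_of_subset[OF openin_subset[OF Yo]] by auto
  qed
  have "twin a" if "d \<subseteq> a" "e \<subseteq> a"
    using that w unfolding twin_def by blast
  moreover have "twin c" if "d \<subseteq> c" "e \<subseteq> c"
    using that w unfolding twin_def by blast
  ultimately show False
    using w mixed[of True] mixed[of False] a(2) c(2) by auto
qed

lemma irreducible_untwinned: "irreducible_in (scott_space (RO X)) untwinned"
proof (rule irreducible_inI)
  show "untwinned \<subseteq> topspace (scott_space (RO X))"
    by (auto simp: untwinned_def topspace_scott_space)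
  show "untwinned \<noteq> {}"
    using half_untwinned by blast
next
  fix U V a c
  assume "openin (scott_space (RO X)) U" "openin (scott_space (RO X)) V"
  then have U: "scott_open (RO X) U" and V: "scott_open (RO X) V"
    by (simp_all add: openin_scott_space)
  assume "a \<in> untwinned \<inter> U" "c \<in> untwinned \<inter> V"
  then have a: "a \<in> U" "regular_openin X a" "a \<subseteq> A []" "\<not> twin a"
    and c: "c \<in> V" "regular_openin X c" "c \<subseteq> A []" "\<not> twin c"
    by (auto simp: untwinned_def)
  obtain Y where Y: "\<And>n. symmetric (Y n)" "\<And>n. a - X closure_of (Y n) \<in> U" "incseq Y"
    "\<And>s. A s \<inter> (\<Union>n. Y n) \<noteq> {}"
    using symmetric_exhausting_sequence[OF U a(1,3)] by blast
  define f where "f n = X interior_of (X closure_of (c \<inter> Y n))" for n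
  have "\<exists>n. f n \<in> V"
  proof (rule scott_open_RO_incseq[OF V c(1)])
    show "regular_openin X (f n)" for n
      unfolding f_def by (rule regular_openin_int_cl)
    show "f n \<subseteq> c" for n
      unfolding f_def using c(2) by (rule int_cl_minimal) blast
    show "incseq f"
      using Y(3) unfolding f_def mono_def
      by (intro allI impI interior_of_mono closure_of_mono) blast
    have "c \<inter> Y n \<subseteq> f n" for n
      unfolding f_def using c(2) Y(1)[of n]
      by (intro open_subset_int_cl) (auto simp: symmetric_def regular_openin_openin)
    then have "c \<inter> (\<Union>n. Y n) \<subseteq> (\<Union>n. f n)"
      by blast
    then show "c \<subseteq> X closure_of (\<Union>n. f n)"
    proof (intro subset_closure_ofI c regular_openin_openin)
      fix s assume "A s \<subseteq> c"
      then show "A s \<inter> (\<Union>n. f n) \<noteq> {}"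
        using Y(4)[of s] \<open>c \<inter> (\<Union>n. Y n) \<subseteq> (\<Union>n. f n)\<close> by blast
    qed
  qed
  \<comment> \<open>Only \<open>V\<close> restricts \<open>n\<close>, since removing any
    \<open>Y n\<close> leaves \<open>a\<close> in \<open>U\<close>; hence one index serves both
    sets.\<close>
  then obtain n where n: "f n \<in> V" by blast
  let ?S = "(a - X closure_of (Y n)) \<union> (c \<inter> Y n)"
  let ?e = "X interior_of (X closure_of ?S)"
  have "?e \<in> untwinned"
    using not_twin_symmetric_mix[OF a(2,4) c(2,4) Y(1)] int_cl_minimal[OF regular_root, of ?S] a(3) c(3)
    by (auto simp: untwinned_def regular_openin_int_cl simp del: closure_of_Un)
  moreover have "openin X ?S"
    using a(2) c(2) Y(1)[of n]
    by (auto simp: symmetric_def openin_diff openin_Int openin_Un regular_openin_openin)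
  then have "a - X closure_of (Y n) \<subseteq> ?e"
    using open_subset_int_cl by blast
  then have "?e \<in> U"
    using scott_open_upward[OF U Y(2)[of n]] by (simp add: regular_openin_int_cl del: closure_of_Un)
  moreover have "f n \<subseteq> ?e"
    unfolding f_def by (intro interior_of_mono closure_of_mono) blast
  then have "?e \<in> V"
    using scott_open_upward[OF V n] by (simp add: regular_openin_int_cl del: closure_of_Un)
  ultimately show "untwinned \<inter> (U \<inter> V) \<noteq> {}"
    by blast
qed

lemma not_sober: "\<not> sober_space (scott_space (RO X))"
proof
  assume "sober_space (scott_space (RO X))"
  then obtain m where "regular_openin X m" "untwinned = scott_space (RO X) closure_of {m}"
    using closedin_untwinned irreducible_untwinned
    unfolding sober_space_def topspace_scott_space by auto
  then show False
    using untwinned_not_principal[of m] by (simp add: scott_closure_of_singleton_RO)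
qed

end

section \<open>Existence of dense binary trees\<close>

text \<open>The open set \<open>G\<close> has two points because none is isolated; a neighbourhood
  of one whose closure omits the other gives a proper piece. The clause on \<open>P\<close> is what
  will make the tree dense.\<close>

lemma exists_split:
  assumes X: "Hausdorff_space X" and U: "openin X U" "U \<noteq> {}" "U \<inter> Iso X = {}" and P: "openin X P"
  shows "\<exists>V. openin X V \<and> V \<noteq> {} \<and> V \<subseteq> U \<and> U - X closure_of V \<noteq> {} \<and>
    (U \<inter> P \<noteq> {} \<longrightarrow> V \<subseteq> P)"
proof -
  define G where "G = (if U \<inter> P \<noteq> {} then U \<inter> P else U)"
  have G: "openin X G" "G \<noteq> {}" "G \<subseteq> U" "U \<inter> P \<noteq> {} \<longrightarrow> G \<subseteq> P"
    using U P by (auto simp: G_def openin_Int)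
  then obtain x where x: "x \<in> G" by blast
  have "G \<noteq> {x}"
    using x G U openin_subset[OF G(1)] by (auto simp: Iso_def)
  then obtain y where y: "y \<in> G" "y \<noteq> x"
    using x by blast
  obtain M N where MN: "openin X M" "openin X N" "x \<in> M" "y \<in> N" "disjnt M N"
    using X x y openin_subset[OF G(1)] unfolding Hausdorff_space_def by (metis subsetD)
  have "y \<notin> X closure_of (G \<inter> M)"
    using MN by (auto simp: in_closure_of disjnt_def)
  then show ?thesis
    using G MN x y by (intro exI[of _ "G \<inter> M"]) (auto simp: openin_Int)
qed

lemma second_countable_enum_basis:
  assumes "second_countable X"
  obtains P :: "nat \<Rightarrow> 'a set"
  where "\<And>n. openin X (P n)" "\<And>W x. openin X W \<Longrightarrow> x \<in> W \<Longrightarrow> \<exists>n. x \<in> P n \<and> P n \<subseteq> W"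
proof -
  obtain \<B> where \<B>: "countable \<B>" "\<forall>V \<in> \<B>. openin X V"
    "\<forall>U x. openin X U \<and> x \<in> U \<longrightarrow> (\<exists>V \<in> \<B>. x \<in> V \<and> V \<subseteq> U)"
    using assms unfolding second_countable_def by blast
  \<comment> \<open>The empty set is inserted so that the enumerated set is nonempty and
    \<open>range_from_nat_into\<close> applies; as an extra open set it is harmless.\<close>
  let ?P = "from_nat_into (insert {} \<B>)"
  have r: "range ?P = insert {} \<B>"
    using \<B>(1) by (simp add: range_from_nat_into)
  show thesis
  proof
    show "openin X (?P n)" for n
      using r \<B>(2) by (metis insert_iff openin_empty rangeI)
    show "\<exists>n. x \<in> ?P n \<and> ?P n \<subseteq> W" if W: "openin X W" "x \<in> W" for W x
    proof -
      obtain V where V: "V \<in> \<B>" "x \<in> V" "V \<subseteq> W"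
        using \<B>(3) W by blast
      then obtain n where "V = ?P n"
        using r by (metis imageE insertI2)
      then show ?thesis
        using V by blast
    qed
  qed
qed

text \<open>Level \<open>n\<close> handles the basic set \<open>P n\<close>: a node meeting
  \<open>P n\<close> gets a \<open>True\<close> child inside \<open>P n\<close>, and the
  \<open>False\<close> child is the rest of the node outside the closure of that child. The nodes of
  each level have dense union in \<open>R\<close>, so every basic set meeting \<open>R\<close>
  contains a node.\<close>

lemma exists_dense_binary_tree:
  fixes X :: "'a topology"
  assumes X: "second_countable X" "Hausdorff_space X"
    and R: "regular_openin X R" "R \<noteq> {}" "R \<inter> Iso X = {}"
  shows "\<exists>A. dense_binary_tree X A"
proof -
  obtain P :: "nat \<Rightarrow> 'a set" where P: "\<And>n. openin X (P n)"
    "\<And>W x. openin X W \<Longrightarrow> x \<in> W \<Longrightarrow> \<exists>n. x \<in> P n \<and> P n \<subseteq> W"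
    using second_countable_enum_basis[OF X(1)] by blast
  define good where "good U V n \<longleftrightarrow> openin X V \<and> V \<noteq> {} \<and> V \<subseteq> U \<and> U - X closure_of V \<noteq> {} \<and>
    (U \<inter> P n \<noteq> {} \<longrightarrow> V \<subseteq> P n)" for U V n
  define split where "split U n = (SOME V. good U V n)" for U n
  define A where "A = rec_list R
    (\<lambda>b s U. if b then split U (length s) else U - X closure_of split U (length s))"
  have A_Nil: "A [] = R"
    and A_True: "A (True # s) = split (A s) (length s)"
    and A_False: "A (False # s) = A s - X closure_of split (A s) (length s)" for s
    by (simp_all add: A_def)
  have split: "good U (split U n) n" if "openin X U" "U \<noteq> {}" "U \<subseteq> R" for U n
    unfolding split_def good_def using that R(3)
    by (intro someI_ex[OF exists_split] X P) auto
  have node: "openin X (A s) \<and> A s \<noteq> {} \<and> A s \<subseteq> R" for s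
  proof (induction s)
    case Nil
    then show ?case
      using R by (simp add: A_Nil regular_openin_openin)
  next
    case (Cons b s)
    then have "good (A s) (split (A s) (length s)) (length s)"
      using split by blast
    then show ?case
      using Cons by (cases b) (auto simp: good_def A_True A_False openin_diff)
  qed
  have step: "good (A s) (A (True # s)) (length s)" for s
    using split node by (simp add: A_True)
  have A_False': "A (False # s) = A s - X closure_of A (True # s)" for s
    by (simp add: A_True A_False)
  \<comment> \<open>An open subset of \<open>A s\<close> that misses the \<open>True\<close> child
    also misses its closure, hence lies in the \<open>False\<close> child.\<close>
  have level: "\<exists>s. length s = n \<and> A s \<inter> W \<noteq> {}" if W: "openin X W" "W \<inter> R \<noteq> {}" for W n
  proof (induction n)
    case 0
    then show ?case
      using W by (simp add: A_Nil Int_commute)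
  next
    case (Suc n)
    then obtain s where s: "length s = n" "A s \<inter> W \<noteq> {}" by blast
    have "A (True # s) \<inter> W \<noteq> {} \<or> A (False # s) \<inter> W \<noteq> {}"
    proof (rule ccontr)
      assume no: "\<not> ?thesis"
      then have "(A s \<inter> W) \<inter> X closure_of (A (True # s)) = {}"
        using openin_Int_closure_of_eq_empty[of X "A s \<inter> W" "A (True # s)"] node W(1)
        by (auto simp: openin_Int)
      then show False
        using no s(2) unfolding A_False' by blast
    qed
    then show ?case
      using s(1) by (metis length_Cons)
  qed
  have "dense_binary_tree X A"
  proof
    show "regular_openin X (A [])"
      by (simp add: A_Nil R)
    show "openin X (A s)" "A s \<noteq> {}" for s
      using node by auto
    show "A (b # s) \<subseteq> A s" for b s
      using step[of s] by (cases b) (auto simp: good_def A_False')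
    show "A (True # s) \<inter> A (False # s) = {}" for s
      using closure_of_subset[OF openin_subset, of X "A (True # s)"] node
      unfolding A_False' by blast
    show "\<exists>s. A s \<subseteq> W" if W: "openin X W" "W \<inter> A [] \<noteq> {}" for W
    proof -
      obtain x where x: "x \<in> W" "x \<in> R"
        using W by (auto simp: A_Nil)
      then obtain n where n: "x \<in> P n" "P n \<subseteq> W"
        using P(2) W by blast
      then obtain s where "length s = n" "A s \<inter> P n \<noteq> {}"
        using level[of "P n" n] P(1) x by blast
      then have "A (True # s) \<subseteq> P n"
        using step[of s] by (simp add: good_def)
      then show ?thesis
        using n by blast
    qed
  qed
  then show ?thesis by blast
qed

theorem mainTheorem1:
  fixes X :: "'a topology"
  assumes "second_countable X" and "regular_space X" and "t1_space X"
  shows "(sober_space (scott_space (RO X)) \<longleftrightarrow> atomic_order (RO X)) \<and>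
         (atomic_order (RO X) \<longleftrightarrow> X closure_of (Iso X) = topspace X)"
proof -
  have H: "Hausdorff_space X"
    using assms by (simp add: regular_t1_imp_Hausdorff_space)
  \<comment> \<open>By contraposition: a nonempty regular open set without isolated points carries a
    tree, and a tree refutes sobriety.\<close>
  have "X closure_of (Iso X) = topspace X" if sober: "sober_space (scott_space (RO X))"
  proof (rule ccontr)
    assume "\<not> ?thesis"
    then have "topspace X - X closure_of (Iso X) \<noteq> {}"
      using closure_of_subset_topspace[of X "Iso X"] by blast
    moreover have "(topspace X - X closure_of (Iso X)) \<inter> Iso X = {}"
      using closure_of_subset[of "Iso X" X] by (auto simp: Iso_def)
    ultimately obtain A where "dense_binary_tree X A"
      using exists_dense_binary_tree[OF assms(1) H regular_openin_complement_Iso] by blast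
    then show False
      using dense_binary_tree.not_sober sober by blast
  qed
  then show ?thesis
    using sober_scott_RO_if_Iso_dense atomic_RO_iff_Iso_dense[OF H] by blast
qed

end
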